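(* Let $(\mathcal{L},T_* )$ be a real-valued logic. Then $\mathcal{L}$ satisfies principle (P2) if, and only if, $\mathcal{L}$ is an extension of {\L}ukasiewicz logic $\mathbf{L}$.
   Context: Formulas $\mathrm{Form}$ are built from countably many propositional variables $X_1,X_2,\dots$ with primitive connectives $\to$, $\&$, $\bot$; $\neg\alpha:=\alpha\to\bot$. $\mathbf{BL}$ is H\'ajek's Basic Logic (the logic of all continuous t-norms and their residua). An extension of $\mathbf{BL}$ is a consistent set of formulas closed under the consequence relation of $\mathbf{BL}$ and under substitutions. A t-norm here is a continuous, associative, commutative binary operation $*$ on $[0,1]$ with neutral element $1$, non-decreasing in each argument; its residuum is $a\to_* b:=\max\{c\in[0,1]: a*c\le b\}$. An algebra of truth values $T_*$ is a subalgebra (containing $0,1$, closed under $*$ and $\to_*$) of a BL-algebra $([0,1],*,\to_*,0)$ with $*$ a continuous t-norm; valuations $\mu:\mathrm{Form}\to T_*$ interpret $\&$ by $*$, $\to$ by $\to_*$, $\bot$ by $0$. A pair $(\mathcal{L},T_* )$ is a real-valued logic if $\mathcal{L}$ is an extension of $\mathbf{BL}$ complete with respect to valuations into $T_*$ (i.e. $\vdash_{\mathcal{L}}\alpha$ iff $\mu(\alpha)=1$ for all valuations $\mu$ into $T_*$); any such $T_*$ is said to induce $\mathcal{L}$. {\L}ukasiewicz logic $\mathbf{L}$ is $\mathbf{BL}$ extended by the schema $\neg\neg\varphi\to\varphi$. Principle (P2) for $\mathcal{L}$: for every algebra of truth values $T_*$ inducing $\mathcal{L}$ and every pair of valuations $\mu,\nu:\mathrm{Form}\to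 T_*$ with $\mu\neq\nu$, there is a formula $\alpha$ with $\mu(\alpha)>0$ and $\nu(\alpha)=0$. *)

theory Defs
  imports Complex_Main
begin

datatype form =
    Var nat
  | Bot
  | Imp form form  (infixr "\<^bold>\<rightarrow>" 55)
  | Conj form form  (infixr "\<^bold>&" 60)

abbreviation Neg :: "form \<Rightarrow> form"
  where "Neg \<phi> \<equiv> \<phi> \<^bold>\<rightarrow> Bot"

primrec subst :: "(nat \<Rightarrow> form) \<Rightarrow> form \<Rightarrow> form" where
  "subst \<sigma> (Var n) = \<sigma> n"
| "subst \<sigma> Bot = Bot"
| "subst \<sigma> (\<phi> \<^bold>\<rightarrow> \<psi>) = subst \<sigma> \<phi> \<^bold>\<rightarrow> subst \<sigma> \<psi>"
| "subst \<sigma> (\<phi> \<^bold>& \<psi>) = subst \<sigma> \<phi> \<^bold>& subst \<sigma> \<psi>"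

text \<open>Hajek's axiom schemata (A1)--(A7) for Basic Logic.\<close>

inductive_set BL_axioms :: "form set" where
  A1: "(\<phi> \<^bold>\<rightarrow> \<psi>) \<^bold>\<rightarrow> (\<psi> \<^bold>\<rightarrow> \<chi>) \<^bold>\<rightarrow> (\<phi> \<^bold>\<rightarrow> \<chi>) \<in> BL_axioms"
| A2: "\<phi> \<^bold>& \<psi> \<^bold>\<rightarrow> \<phi> \<in> BL_axioms"
| A3: "\<phi> \<^bold>& \<psi> \<^bold>\<rightarrow> \<psi> \<^bold>& \<phi> \<in> BL_axioms"
| A4: "\<phi> \<^bold>& (\<phi> \<^bold>\<rightarrow> \<psi>) \<^bold>\<rightarrow> \<psi> \<^bold>& (\<psi> \<^bold>\<rightarrow> \<phi>) \<in> BL_axioms"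
| A5a: "(\<phi> \<^bold>\<rightarrow> (\<psi> \<^bold>\<rightarrow> \<chi>)) \<^bold>\<rightarrow> (\<phi> \<^bold>& \<psi> \<^bold>\<rightarrow> \<chi>) \<in> BL_axioms"
| A5b: "(\<phi> \<^bold>& \<psi> \<^bold>\<rightarrow> \<chi>) \<^bold>\<rightarrow> (\<phi> \<^bold>\<rightarrow> (\<psi> \<^bold>\<rightarrow> \<chi>)) \<in> BL_axioms"
| A6: "((\<phi> \<^bold>\<rightarrow> \<psi>) \<^bold>\<rightarrow> \<chi>) \<^bold>\<rightarrow> ((\<psi> \<^bold>\<rightarrow> \<phi>) \<^bold>\<rightarrow> \<chi>) \<^bold>\<rightarrow> \<chi> \<in> BL_axioms"
| A7: "Bot \<^bold>\<rightarrow> \<phi> \<in> BL_axioms"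

definition Luk_axioms :: "form set"
  where "Luk_axioms = BL_axioms \<union> {Neg (Neg \<phi>) \<^bold>\<rightarrow> \<phi> | \<phi>. True}"

text \<open>\<open>derives Ax \<Gamma> \<phi>\<close>: the formula \<open>\<phi>\<close> is derivable from the hypotheses \<open>\<Gamma>\<close> in the calculus
  with axiom set \<open>Ax\<close> and modus ponens as its only rule.\<close>

inductive derives :: "form set \<Rightarrow> form set \<Rightarrow> form \<Rightarrow> bool" for Ax \<Gamma> where
  axiom: "\<phi> \<in> Ax \<Longrightarrow> derives Ax \<Gamma> \<phi>"
| hyp: "\<phi> \<in> \<Gamma> \<Longrightarrow> derives Ax \<Gamma> \<phi>"
| mp: "derives Ax \<Gamma> \<phi> \<Longrightarrow> derives Ax \<Gamma> (\<phi> \<^bold>\<rightarrow> \<psi>) \<Longrightarrow> derives Ax \<Gamma> \<psi>"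

definition extension_of :: "form set \<Rightarrow> form set \<Rightarrow> bool" where
  "extension_of Ax L \<longleftrightarrow>
     \<not> derives Ax L Bot \<and>
     (\<forall>\<phi>. derives Ax L \<phi> \<longrightarrow> \<phi> \<in> L) \<and>
     (\<forall>\<sigma>. \<forall>\<phi>\<in>L. subst \<sigma> \<phi> \<in> L)"

text \<open>The values of \<open>m\<close> outside the unit square are irrelevant.\<close>

definition continuous_tnorm :: "(real \<Rightarrow> real \<Rightarrow> real) \<Rightarrow> bool" where
  "continuous_tnorm m \<longleftrightarrow>
     (\<forall>x\<in>{0..1}. \<forall>y\<in>{0..1}. m x y \<in> {0..1}) \<and>
     continuous_on ({0..1} \<times> {0..1}) (\<lambda>(x, y). m x y) \<and>
     (\<forall>x\<in>{0..1}. \<forall>y\<in>{0..1}. \<forall>z\<in>{0..1}. m (m x y) z = m x (m y z)) \<and>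
     (\<forall>x\<in>{0..1}. \<forall>y\<in>{0..1}. m x y = m y x) \<and>
     (\<forall>x\<in>{0..1}. m x 1 = x) \<and>
     (\<forall>x\<in>{0..1}. \<forall>x'\<in>{0..1}. \<forall>y\<in>{0..1}. \<forall>y'\<in>{0..1}.
        x \<le> x' \<longrightarrow> y \<le> y' \<longrightarrow> m x y \<le> m x' y')"

definition residuum :: "(real \<Rightarrow> real \<Rightarrow> real) \<Rightarrow> real \<Rightarrow> real \<Rightarrow> real"
  where "residuum m a b = (GREATEST c. c \<in> {0..1} \<and> m a c \<le> b)"

definition truth_algebra :: "(real \<Rightarrow> real \<Rightarrow> real) \<Rightarrow> real set \<Rightarrow> bool" where
  "truth_algebra m T \<longleftrightarrow>
     continuous_tnorm m \<and> T \<subseteq> {0..1} \<and> 0 \<in> T \<and> 1 \<in> T \<and>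
     (\<forall>a\<in>T. \<forall>b\<in>T. m a b \<in> T \<and> residuum m a b \<in> T)"

definition valuation :: "(real \<Rightarrow> real \<Rightarrow> real) \<Rightarrow> real set \<Rightarrow> (form \<Rightarrow> real) \<Rightarrow> bool" where
  "valuation m T \<mu> \<longleftrightarrow>
     range \<mu> \<subseteq> T \<and>
     \<mu> Bot = 0 \<and>
     (\<forall>\<phi> \<psi>. \<mu> (\<phi> \<^bold>& \<psi>) = m (\<mu> \<phi>) (\<mu> \<psi>)) \<and>
     (\<forall>\<phi> \<psi>. \<mu> (\<phi> \<^bold>\<rightarrow> \<psi>) = residuum m (\<mu> \<phi>) (\<mu> \<psi>))"

definition real_valued_logic :: "form set \<Rightarrow> (real \<Rightarrow> real \<Rightarrow> real) \<Rightarrow> real set \<Rightarrow> bool" where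
  "real_valued_logic L m T \<longleftrightarrow>
     extension_of BL_axioms L \<and> truth_algebra m T \<and>
     (\<forall>\<alpha>. \<alpha> \<in> L \<longleftrightarrow> (\<forall>\<mu>. valuation m T \<mu> \<longrightarrow> \<mu> \<alpha> = 1))"

definition P2 :: "form set \<Rightarrow> bool" where
  "P2 L \<longleftrightarrow>
     (\<forall>m T. real_valued_logic L m T \<longrightarrow>
        (\<forall>\<mu> \<nu>. valuation m T \<mu> \<longrightarrow> valuation m T \<nu> \<longrightarrow> \<mu> \<noteq> \<nu> \<longrightarrow>
           (\<exists>\<alpha>. \<mu> \<alpha> > 0 \<and> \<nu> \<alpha> = 0)))"

end

theory Submission
  imports Defs
begin

text \<open>
  On a BL-chain of reals, double negation is an endomorphism. If some value \<open>x\<close> of \<open>T\<close> satisfies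
  \<open>x < \<not>\<not>x\<close>, a valuation \<open>\<mu>\<close> taking the value \<open>x\<close> therefore differs from the valuation \<open>\<not>\<not>\<mu>\<close>;
  since \<open>\<not>\<not>\<mu> \<ge> \<mu>\<close>, no formula is positive under \<open>\<mu>\<close> and zero under \<open>\<not>\<not>\<mu>\<close>, so (P2) fails.

  Conversely, let negation be involutive on \<open>T\<close>. Iterated squaring drives every value below \<open>1\<close>
  to \<open>0\<close>, because the limit of the iterates is an idempotent. If \<open>\<mu> \<alpha> < \<nu> \<alpha>\<close>, replace \<open>\<alpha>\<close> by
  \<open>\<alpha> & \<alpha>\<close> as long as both values have nonzero squares, and by \<open>\<not>\<alpha> & \<not>\<alpha>\<close> as long as both
  negations have nonzero squares. In the standard MV-algebra this is the binary expansion: each step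
  doubles the distance of the two values, and abstractly it squares the residuum of the larger by the
  smaller one. Hence after finitely many steps exactly one of the two values is \<open>0\<close>.
\<close>

section \<open>Residuated structure of a continuous t-norm on the unit interval\<close>

locale tnorm =
  fixes m :: "real \<Rightarrow> real \<Rightarrow> real" (infixl "\<odot>" 70)
  assumes tnorm: "continuous_tnorm m"
begin

abbreviation imp :: "real \<Rightarrow> real \<Rightarrow> real" (infixr "\<rightharpoonup>" 60)
  where "a \<rightharpoonup> b \<equiv> residuum m a b"

abbreviation neg :: "real \<Rightarrow> real" ("\<sim> _" [80] 80)
  where "\<sim> a \<equiv> a \<rightharpoonup> 0"

lemma mult_closed [simp, intro]: "a \<in> {0..1} \<Longrightarrow> b \<in> {0..1} \<Longrightarrow> a \<odot> b \<in> {0..1}"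
  using tnorm unfolding continuous_tnorm_def by blast

lemma mult_assoc: "a \<in> {0..1} \<Longrightarrow> b \<in> {0..1} \<Longrightarrow> c \<in> {0..1} \<Longrightarrow> (a \<odot> b) \<odot> c = a \<odot> (b \<odot> c)"
  using tnorm unfolding continuous_tnorm_def by blast

lemma mult_commute: "a \<in> {0..1} \<Longrightarrow> b \<in> {0..1} \<Longrightarrow> a \<odot> b = b \<odot> a"
  using tnorm unfolding continuous_tnorm_def by blast

lemma mult_left_commute:
  "a \<in> {0..1} \<Longrightarrow> b \<in> {0..1} \<Longrightarrow> c \<in> {0..1} \<Longrightarrow> a \<odot> (b \<odot> c) = b \<odot> (a \<odot> c)"
  by (metis mult_assoc mult_commute)

lemma mult_one_right: "a \<in> {0..1} \<Longrightarrow> a \<odot> 1 = a"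
  using tnorm unfolding continuous_tnorm_def by blast

lemma mult_mono:
  "a \<in> {0..1} \<Longrightarrow> a' \<in> {0..1} \<Longrightarrow> b \<in> {0..1} \<Longrightarrow> b' \<in> {0..1} \<Longrightarrow> a \<le> a' \<Longrightarrow> b \<le> b' \<Longrightarrow>
    a \<odot> b \<le> a' \<odot> b'"
  using tnorm unfolding continuous_tnorm_def by blast

lemma mult_le_left: "a \<in> {0..1} \<Longrightarrow> b \<in> {0..1} \<Longrightarrow> a \<odot> b \<le> a"
  using mult_mono[of a a b 1] mult_one_right[of a] by simp

lemma mult_le_right: "a \<in> {0..1} \<Longrightarrow> b \<in> {0..1} \<Longrightarrow> a \<odot> b \<le> b"
  using mult_le_left[of b a] mult_commute by simp

lemma mult_zero_right: "a \<in> {0..1} \<Longrightarrow> a \<odot> 0 = 0"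
  using mult_le_right[of a 0] mult_closed[of a 0] by simp

lemma continuous_on_mult_left:
  assumes "a \<in> {0..1}"
  shows "continuous_on {0..1} (\<lambda>c. a \<odot> c)"
proof -
  have "continuous_on ({0..1} \<times> {0..1}) (\<lambda>(x, y). x \<odot> y)"
    using tnorm unfolding continuous_tnorm_def by blast
  then have "continuous_on {0..1} (\<lambda>c. (\<lambda>(x, y). x \<odot> y) (a, c))"
    by (rule continuous_on_compose2) (use assms in \<open>auto intro!: continuous_intros\<close>)
  then show ?thesis by simp
qed

text \<open>The candidates \<open>c\<close> form a compact set containing 0, so
  \<open>GREATEST\<close> in the definition of the residuum denotes an attained maximum.\<close>

lemma residuum_greatest:
  assumes a: "a \<in> {0..1}" and b: "b \<in> {0..1}"
  shows "a \<rightharpoonup> b \<in> {0..1}" "a \<odot> (a \<rightharpoonup> b) \<le> b"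
    "\<And>c. c \<in> {0..1} \<Longrightarrow> a \<odot> c \<le> b \<Longrightarrow> c \<le> a \<rightharpoonup> b"
proof -
  define S where "S = {0..1} \<inter> (\<lambda>c. a \<odot> c) -` {..b}"
  have "closed S"
    unfolding S_def
    by (metis a closed_atLeastAtMost closed_atMost continuous_on_closed_vimage
        continuous_on_mult_left inf_commute)
  moreover have "S = {0..1} \<inter> S" by (auto simp: S_def)
  ultimately have "compact S"
    by (metis compact_Int_closed compact_Icc)
  moreover have "0 \<in> S" using a b mult_zero_right[of a] by (simp add: S_def)
  ultimately obtain s where s: "s \<in> S" "\<And>c. c \<in> S \<Longrightarrow> c \<le> s"
    using compact_attains_sup[of S] by blast
  have "a \<rightharpoonup> b = s"
    unfolding residuum_def using s by (intro Greatest_equality) (auto simp: S_def)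
  then show "a \<rightharpoonup> b \<in> {0..1}" "a \<odot> (a \<rightharpoonup> b) \<le> b"
    "\<And>c. c \<in> {0..1} \<Longrightarrow> a \<odot> c \<le> b \<Longrightarrow> c \<le> a \<rightharpoonup> b"
    using s by (auto simp: S_def)
qed

lemma imp_closed [simp, intro]: "a \<in> {0..1} \<Longrightarrow> b \<in> {0..1} \<Longrightarrow> a \<rightharpoonup> b \<in> {0..1}"
  by (rule residuum_greatest)

lemma zero_closed [simp]: "(0::real) \<in> {0..1}" and one_closed [simp]: "(1::real) \<in> {0..1}"
  by simp_all

text \<open>Keeps membership in \<open>{0..1}\<close> as an atom that the closure rules above can
  discharge.\<close>

declare atLeastAtMost_iff [simp del]

lemma residuation:
  assumes "a \<in> {0..1}" "b \<in> {0..1}" "c \<in> {0..1}"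
  shows "c \<le> a \<rightharpoonup> b \<longleftrightarrow> a \<odot> c \<le> b"
proof
  assume "c \<le> a \<rightharpoonup> b"
  then have "a \<odot> c \<le> a \<odot> (a \<rightharpoonup> b)" using assms by (intro mult_mono) auto
  then show "a \<odot> c \<le> b" using residuum_greatest(2)[of a b] assms by linarith
qed (use assms residuum_greatest(3) in blast)

text \<open>Turns an equation between residua into equivalences that \<open>residuation\<close> can
  rewrite.\<close>

lemma eq_by_lower_bounds:
  assumes "a \<in> {0..1}" "b \<in> {0..1}" "\<And>c. c \<in> {0..1} \<Longrightarrow> c \<le> a \<longleftrightarrow> c \<le> b"
  shows "a = (b::real)"
  using assms by (metis order.antisym order.refl)

lemma imp_mult:
  assumes "a \<in> {0..1}" "b \<in> {0..1}" "c \<in> {0..1}"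
  shows "(a \<odot> b) \<rightharpoonup> c = a \<rightharpoonup> b \<rightharpoonup> c"
  by (rule eq_by_lower_bounds) (use assms in \<open>simp_all add: residuation mult_assoc mult_left_commute\<close>)

lemma imp_left_commute:
  assumes "a \<in> {0..1}" "b \<in> {0..1}" "c \<in> {0..1}"
  shows "a \<rightharpoonup> b \<rightharpoonup> c = b \<rightharpoonup> a \<rightharpoonup> c"
  by (metis assms imp_mult mult_commute)

lemma imp_eq_one_iff:
  assumes "a \<in> {0..1}" "b \<in> {0..1}"
  shows "a \<rightharpoonup> b = 1 \<longleftrightarrow> a \<le> b"
  using residuation[of a b 1] assms imp_closed[of a b] mult_one_right[of a]
  by (auto simp: atLeastAtMost_iff)

lemma le_imp: "a \<in> {0..1} \<Longrightarrow> b \<in> {0..1} \<Longrightarrow> b \<le> a \<rightharpoonup> b"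
  by (simp add: residuation mult_le_right)

lemma mult_imp_le: "a \<in> {0..1} \<Longrightarrow> b \<in> {0..1} \<Longrightarrow> a \<odot> (a \<rightharpoonup> b) \<le> b"
  by (rule residuum_greatest)

text \<open>Divisibility; this is where continuity of the t-norm enters.\<close>

lemma mult_imp_eq_min:
  assumes a: "a \<in> {0..1}" and b: "b \<in> {0..1}"
  shows "a \<odot> (a \<rightharpoonup> b) = min a b"
proof (cases "a \<le> b")
  case True
  then have "a \<rightharpoonup> b = 1" using imp_eq_one_iff assms by blast
  then show ?thesis using True a mult_one_right by simp
next
  case False
  \<comment> \<open>Multiplication by \<open>a\<close> runs continuously from 0 at 0 to
    \<open>a\<close> at 1, and \<open>b\<close> lies in between.\<close>
  have "\<exists>c\<ge>0. c \<le> 1 \<and> a \<odot> c = b"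
    using a b False
    by (intro IVT' continuous_on_mult_left)
      (auto simp: mult_zero_right mult_one_right atLeastAtMost_iff)
  then obtain c where c: "c \<in> {0..1}" "a \<odot> c = b" by (auto simp: atLeastAtMost_iff)
  then have "c \<le> a \<rightharpoonup> b" using assms by (simp add: residuation)
  then have "b \<le> a \<odot> (a \<rightharpoonup> b)" using mult_mono[of a a c "a \<rightharpoonup> b"] c assms by simp
  then show ?thesis using False mult_imp_le[of a b] assms by simp
qed

lemma imp_mono_right:
  assumes "a \<in> {0..1}" "b \<in> {0..1}" "c \<in> {0..1}" "b \<le> c"
  shows "a \<rightharpoonup> b \<le> a \<rightharpoonup> c"
  using assms mult_imp_le[of a b] by (simp add: residuation)

lemma imp_antimono_left:
  assumes "a \<in> {0..1}" "b \<in> {0..1}" "c \<in> {0..1}" "a \<le> b"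
  shows "b \<rightharpoonup> c \<le> a \<rightharpoonup> c"
proof -
  have "a \<odot> (b \<rightharpoonup> c) \<le> b \<odot> (b \<rightharpoonup> c)" using assms by (intro mult_mono) auto
  also have "\<dots> \<le> c" using assms by (simp add: mult_imp_le)
  finally show ?thesis using assms by (simp add: residuation)
qed

section \<open>Negation, and double negation as an endomorphism\<close>

lemma mult_neg: "a \<in> {0..1} \<Longrightarrow> a \<odot> \<sim> a = 0"
  using mult_imp_eq_min[of a 0] by (simp add: atLeastAtMost_iff)

lemma le_neg_iff:
  assumes "a \<in> {0..1}" "b \<in> {0..1}"
  shows "b \<le> \<sim> a \<longleftrightarrow> a \<odot> b = 0"
  using residuation[of a 0 b] mult_closed[of a b] assms by (auto simp: atLeastAtMost_iff)

lemma le_neg_neg: "a \<in> {0..1} \<Longrightarrow> a \<le> \<sim> \<sim> a"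
  by (simp add: le_neg_iff mult_commute[of "\<sim> a" a] mult_neg)

lemma neg_neg_neg:
  assumes "a \<in> {0..1}"
  shows "\<sim> \<sim> \<sim> a = \<sim> a"
  using assms le_neg_neg[of a] le_neg_neg[of "\<sim> a"] imp_antimono_left[of a "\<sim> \<sim> a" 0]
  by (intro antisym) auto

lemma neg_zero: "\<sim> 0 = 1" and neg_one: "\<sim> 1 = 0"
proof -
  show "\<sim> 0 = 1" by (simp add: imp_eq_one_iff)
  show "\<sim> 1 = 0" using mult_neg[of 1] mult_commute[of 1 "\<sim> 1"] mult_one_right[of "\<sim> 1"] by simp
qed

text \<open>Write \<open>y\<close> for \<open>\<sim> \<sim> x\<close> and \<open>e\<close> for the
  residuum \<open>y \<rightharpoonup> x\<close>. The product of \<open>e\<close> and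
  \<open>\<sim> y\<close> turns out to be their minimum. If it is \<open>\<sim> y\<close>, then
  \<open>e\<close> also absorbs \<open>\<sim> e\<close>, which is thus 0; if it is \<open>e\<close>,
  then \<open>x\<close> is a multiple of \<open>y \<odot> \<sim> y\<close>, hence 0.\<close>

lemma neg_imp_neg_neg:
  assumes x: "x \<in> {0..1}"
  shows "\<sim> (\<sim> \<sim> x \<rightharpoonup> x) = 0"
proof -
  define y where "y = \<sim> \<sim> x"
  define e where "e = y \<rightharpoonup> x"
  have y: "y \<in> {0..1}" and e: "e \<in> {0..1}" using x by (auto simp: y_def e_def)
  have ny: "\<sim> y = \<sim> x" using x by (simp add: y_def neg_neg_neg)
  have xe: "y \<odot> e = x" using mult_imp_eq_min[OF y x] le_neg_neg[OF x] by (simp add: e_def y_def)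
  \<comment> \<open>As \<open>\<sim> x\<close> equals \<open>\<sim> y\<close>, this reads
    \<open>\<sim> y = e \<rightharpoonup> \<sim> y\<close>, and divisibility yields the
    minimum.\<close>
  have "\<sim> x = e \<rightharpoonup> \<sim> y" using imp_mult[of e y 0] e y xe mult_commute[of y e] by simp
  then have min: "e \<odot> \<sim> y = min e (\<sim> y)" using mult_imp_eq_min[of e "\<sim> y"] e x ny by simp
  show ?thesis
  proof (cases "\<sim> y \<le> e")
    case True
    then have ey: "e \<odot> \<sim> y = \<sim> y" using min by simp
    have "\<sim> e \<le> \<sim> y"
      using imp_antimono_left[of x e 0] le_imp[of y x] x y e ny by (simp add: e_def)
    \<comment> \<open>By divisibility \<open>\<sim> e\<close> is a multiple of
      \<open>\<sim> y\<close>, so it inherits absorption by \<open>e\<close>.\<close>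
    then have ne: "\<sim> y \<odot> (\<sim> y \<rightharpoonup> \<sim> e) = \<sim> e" using mult_imp_eq_min[of "\<sim> y" "\<sim> e"] y e by simp
    have "(e \<odot> \<sim> y) \<odot> (\<sim> y \<rightharpoonup> \<sim> e) = e \<odot> (\<sim> y \<odot> (\<sim> y \<rightharpoonup> \<sim> e))"
      using y e by (intro mult_assoc) auto
    then have "\<sim> e = e \<odot> \<sim> e" by (simp only: ey ne)
    then show ?thesis using e by (simp add: mult_neg e_def y_def)
  next
    case False
    then have ey: "e \<odot> \<sim> y = e" using min by simp
    have "x = y \<odot> (\<sim> y \<odot> e)" using xe ey mult_commute[of e "\<sim> y"] y e by simp
    also have "\<dots> = (y \<odot> \<sim> y) \<odot> e" using y e by (simp add: mult_assoc)
    also have "\<dots> = 0" using y e mult_commute[of 0 e] by (simp add: mult_neg mult_zero_right)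
    finally have "x = 0" .
    then show ?thesis by (simp add: neg_zero neg_one)
  qed
qed

lemma neg_mult_neg_neg:
  assumes "a \<in> {0..1}" "b \<in> {0..1}"
  shows "\<sim> (\<sim> \<sim> a \<odot> b) = \<sim> (a \<odot> b)"
proof -
  have "\<sim> (\<sim> \<sim> a \<odot> b) = \<sim> (b \<odot> \<sim> \<sim> a)" using assms mult_commute[of b "\<sim> \<sim> a"] by simp
  also have "\<dots> = b \<rightharpoonup> \<sim> a" using assms by (simp add: imp_mult neg_neg_neg)
  also have "\<dots> = \<sim> (a \<odot> b)" using assms mult_commute[of b a] imp_mult[of b a 0] by simp
  finally show ?thesis .
qed

text \<open>Unless the product is 0, divisibility gives
  \<open>a \<odot> \<sim> (a \<odot> b) = \<sim> b\<close>. So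
  \<open>a \<rightharpoonup> q = b\<close> for the double negation \<open>q\<close> of the product,
  and multiplying by \<open>a\<close> recovers \<open>q\<close>.\<close>

lemma neg_neg_mult_regular:
  assumes a: "a \<in> {0..1}" "\<sim> \<sim> a = a" and b: "b \<in> {0..1}" "\<sim> \<sim> b = b"
  shows "\<sim> \<sim> (a \<odot> b) = a \<odot> b"
proof (cases "\<sim> b \<le> a")
  case True
  let ?q = "\<sim> \<sim> (a \<odot> b)"
  have ab: "a \<odot> b \<in> {0..1}" using a b by simp
  have "\<sim> \<sim> (a \<odot> b) \<le> \<sim> \<sim> a"
    using a b by (intro imp_antimono_left mult_le_left) auto
  then have qa: "?q \<le> a" using a by simp
  have "a \<rightharpoonup> ?q = \<sim> (a \<odot> \<sim> (a \<odot> b))" using a ab by (simp add: imp_mult)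
  also have "a \<odot> \<sim> (a \<odot> b) = \<sim> b" using a b True by (simp add: imp_mult mult_imp_eq_min)
  finally have "a \<rightharpoonup> ?q = b" using b by simp
  then show ?thesis using mult_imp_eq_min[of a ?q] qa a ab by simp
next
  case False
  then have "b \<odot> a = 0" using le_neg_iff[of b a] a b by simp
  then show ?thesis using a b mult_commute[of a b] by (simp add: neg_zero neg_one)
qed

lemma neg_neg_mult:
  assumes "a \<in> {0..1}" "b \<in> {0..1}"
  shows "\<sim> \<sim> (a \<odot> b) = \<sim> \<sim> a \<odot> \<sim> \<sim> b"
proof -
  have "\<sim> (a \<odot> b) = \<sim> (\<sim> \<sim> b \<odot> \<sim> \<sim> a)"
    using assms neg_mult_neg_neg[of a b] neg_mult_neg_neg[of b "\<sim> \<sim> a"] mult_commute[of b "\<sim> \<sim> a"]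
    by simp
  then show ?thesis
    using neg_neg_mult_regular[of "\<sim> \<sim> a" "\<sim> \<sim> b"] assms mult_commute[of "\<sim> \<sim> a" "\<sim> \<sim> b"]
    by (simp add: neg_neg_neg)
qed

text \<open>With \<open>y\<close> for \<open>\<sim> \<sim> b\<close>, the element
  \<open>e = y \<rightharpoonup> b\<close> has negation 0, so multiplying by \<open>e\<close> does
  not change negations. Since \<open>(a \<rightharpoonup> y) \<odot> e\<close> lies below
  \<open>a \<rightharpoonup> b\<close>, the nontrivial inequality follows.\<close>

lemma neg_neg_imp:
  assumes a: "a \<in> {0..1}" and b: "b \<in> {0..1}"
  shows "\<sim> \<sim> (a \<rightharpoonup> b) = \<sim> \<sim> a \<rightharpoonup> \<sim> \<sim> b"
proof -
  define y where "y = \<sim> \<sim> b"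
  define e where "e = y \<rightharpoonup> b"
  have y: "y \<in> {0..1}" and e: "e \<in> {0..1}" using b by (auto simp: y_def e_def)
  have ay: "a \<rightharpoonup> y = \<sim> (a \<odot> \<sim> b)" using a b by (simp add: imp_mult y_def)
  have "\<sim> \<sim> a \<rightharpoonup> y = \<sim> (\<sim> \<sim> a \<odot> \<sim> b)" using a b by (simp add: imp_mult y_def)
  then have eq: "\<sim> \<sim> a \<rightharpoonup> y = a \<rightharpoonup> y" using a b ay neg_mult_neg_neg by simp
  have reg: "\<sim> \<sim> (a \<rightharpoonup> y) = a \<rightharpoonup> y" using a b ay by (simp add: neg_neg_neg)
  have "\<sim> \<sim> (a \<rightharpoonup> b) \<le> \<sim> \<sim> (a \<rightharpoonup> y)"
    using a b y le_neg_neg[of b] by (intro imp_antimono_left imp_mono_right) (auto simp: y_def)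
  moreover have "\<sim> \<sim> (a \<rightharpoonup> y) \<le> \<sim> \<sim> (a \<rightharpoonup> b)"
  proof -
    have "a \<odot> ((a \<rightharpoonup> y) \<odot> e) = (a \<odot> (a \<rightharpoonup> y)) \<odot> e" using a y e by (simp add: mult_assoc)
    also have "\<dots> \<le> y \<odot> e" using a y e by (intro mult_mono mult_imp_le) auto
    also have "\<dots> \<le> b" using b y by (simp add: e_def mult_imp_le)
    finally have "(a \<rightharpoonup> y) \<odot> e \<le> a \<rightharpoonup> b" using a b y e by (simp add: residuation)
    then have "\<sim> (a \<rightharpoonup> b) \<le> \<sim> ((a \<rightharpoonup> y) \<odot> e)" using a b y e by (intro imp_antimono_left) auto
    also have "\<dots> = \<sim> (a \<rightharpoonup> y)"
      using a b y e neg_imp_neg_neg[of b] by (simp add: imp_mult) (simp add: e_def y_def)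
    finally show ?thesis
      using a b y imp_antimono_left[of "\<sim> (a \<rightharpoonup> b)" "\<sim> (a \<rightharpoonup> y)" 0] by simp
  qed
  ultimately show ?thesis using reg eq by (simp add: y_def)
qed

section \<open>Iterated squaring and idempotents\<close>

lemma idempotent_limit_of_squares:
  assumes x: "x \<in> {0..1}"
  obtains l where "l \<in> {0..1}" "l \<odot> l = l" "l \<le> x" "(\<lambda>k. ((\<lambda>z. z \<odot> z) ^^ k) x) \<longlonglongrightarrow> l"
proof -
  define s where "s k = ((\<lambda>z. z \<odot> z) ^^ k) x" for k
  have s: "s k \<in> {0..1}" for k by (induction k) (auto simp: s_def x)
  have Suc: "s (Suc k) = s k \<odot> s k" for k by (simp add: s_def)
  have dec: "decseq s" using s by (intro decseq_SucI) (simp add: Suc mult_le_left)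
  then obtain l where l: "s \<longlonglongrightarrow> l" "\<And>k. l \<le> s k"
    using s by (metis atLeastAtMost_iff decseq_convergent)
  have l01: "l \<in> {0..1}"
    using l s LIMSEQ_le_const[of s l 0] by (metis atLeastAtMost_iff order_trans)
  have "continuous_on ({0..1} \<times> {0..1}) (\<lambda>(x, y). x \<odot> y)"
    using tnorm unfolding continuous_tnorm_def by blast
  then have "continuous_on {0..1} (\<lambda>c. (\<lambda>(x, y). x \<odot> y) (c, c))"
    by (rule continuous_on_compose2) (auto intro!: continuous_intros)
  then have "(\<lambda>k. s k \<odot> s k) \<longlonglongrightarrow> l \<odot> l"
    using continuous_on_tendsto_compose[of "{0..1}" "\<lambda>c. c \<odot> c" s l] l l01 s by simp
  then have "(\<lambda>k. s (Suc k)) \<longlonglongrightarrow> l \<odot> l" by (simp add: Suc)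
  then have "l \<odot> l = l" using l LIMSEQ_Suc LIMSEQ_unique by blast
  moreover have "l \<le> x" using l(2)[of 0] by (simp add: s_def)
  ultimately show thesis using that[of l] l l01 by (simp add: s_def[abs_def])
qed

text \<open>An idempotent absorbs everything below it: either \<open>l\<close> absorbs
  \<open>\<sim> l\<close>, and their product is 0, or \<open>l \<le> \<sim> l\<close> would force
  \<open>l = l \<odot> l = 0\<close>.\<close>

lemma neg_idempotent:
  assumes l: "l \<in> {0..1}" "l \<odot> l = l" "l \<noteq> 0"
  shows "\<sim> l = 0"
proof (cases "l \<le> \<sim> l")
  case True
  then show ?thesis using l le_neg_iff by simp
next
  case False
  then have "\<sim> l = l \<odot> (l \<rightharpoonup> \<sim> l)" using mult_imp_eq_min[of l "\<sim> l"] l by simp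
  then have "\<sim> l = l \<odot> \<sim> l" using mult_assoc[of l l "l \<rightharpoonup> \<sim> l"] l by simp
  then show ?thesis using l mult_neg by simp
qed

text \<open>A nonzero limit \<open>l \<le> x\<close> would be an idempotent with negation 0, forcing
  \<open>\<sim> x = 0\<close>. So the squares tend to 0, and eventually fall below
  \<open>\<sim> x\<close>.\<close>

lemma squares_nilpotent:
  assumes x: "x \<in> {0..1}" "\<sim> x \<noteq> 0"
  shows "\<exists>k. ((\<lambda>z. z \<odot> z) ^^ k) x = 0"
proof -
  obtain l where l: "l \<in> {0..1}" "l \<odot> l = l" "l \<le> x"
    and lim: "(\<lambda>k. ((\<lambda>z. z \<odot> z) ^^ k) x) \<longlonglongrightarrow> l"
    using idempotent_limit_of_squares x by blast
  have nx: "\<sim> x \<in> {0..1}" using x by simp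
  have "l = 0"
  proof (rule ccontr)
    assume "l \<noteq> 0"
    then have "\<sim> x \<le> 0" using imp_antimono_left[of l x 0] neg_idempotent l x by simp
    then show False using x nx by (simp add: atLeastAtMost_iff)
  qed
  moreover have "0 < \<sim> x" using x nx by (auto simp: atLeastAtMost_iff)
  ultimately have "\<forall>\<^sub>F k in sequentially. ((\<lambda>z. z \<odot> z) ^^ k) x < \<sim> x"
    using lim order_tendstoD(2) by blast
  then obtain k where k: "((\<lambda>z. z \<odot> z) ^^ k) x < \<sim> x"
    by (auto simp: eventually_sequentially)
  let ?s = "((\<lambda>z. z \<odot> z) ^^ k) x"
  have s: "?s \<in> {0..1} \<and> ?s \<le> x"
  proof (induction k)
    case (Suc k)
    then show ?case
      using mult_le_left[of "((\<lambda>z. z \<odot> z) ^^ k) x" "((\<lambda>z. z \<odot> z) ^^ k) x"] by auto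
  qed (use x in simp)
  \<comment> \<open>Convergence alone gives only small values; one more squaring reaches exactly
    0.\<close>
  then have "?s \<odot> ?s \<le> x \<odot> \<sim> x" using k x by (intro mult_mono) auto
  then have "?s \<odot> ?s = 0" using mult_neg[of x] x s mult_closed[of ?s ?s] by (simp add: atLeastAtMost_iff)
  then have "((\<lambda>z. z \<odot> z) ^^ Suc k) x = 0" by simp
  then show ?thesis by blast
qed

text \<open>The MV identity \<open>A \<rightharpoonup> (A \<odot> c) = max (\<sim> A) c\<close>, applied to \<open>A = a \<odot> a\<close> and the square \<open>c\<close> of \<open>a \<rightharpoonup> b\<close>.\<close>

lemma imp_squares:
  assumes a: "a \<in> {0..1}" "\<sim> \<sim> a = a" and b: "b \<in> {0..1}" "\<sim> \<sim> b = b"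
    and "b \<le> a" "b \<odot> b \<noteq> 0"
  shows "(a \<odot> a) \<rightharpoonup> (b \<odot> b) = (a \<rightharpoonup> b) \<odot> (a \<rightharpoonup> b)"
proof -
  define e where "e = a \<rightharpoonup> b"
  define A where "A = a \<odot> a"
  define c where "c = e \<odot> e"
  have e: "e \<in> {0..1}" "\<sim> \<sim> e = e" using a b neg_neg_imp[of a b] by (simp_all add: e_def)
  have A: "A \<in> {0..1}" "\<sim> \<sim> A = A" using a by (simp_all add: A_def neg_neg_mult)
  have c: "c \<in> {0..1}" "\<sim> \<sim> c = c" using e by (simp_all add: c_def neg_neg_mult)
  have ae: "a \<odot> e = b" using mult_imp_eq_min[of a b] assms by (simp add: e_def)
  have "(a \<odot> e) \<odot> (a \<odot> e) = A \<odot> c"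
    using a e by (simp add: A_def c_def mult_assoc mult_left_commute[of e a])
  then have bb: "b \<odot> b = A \<odot> c" by (simp add: ae)
  have "A \<rightharpoonup> (A \<odot> c) = A \<rightharpoonup> \<sim> \<sim> (A \<odot> c)" using A c by (simp add: neg_neg_mult)
  also have "\<dots> = \<sim> (A \<odot> (A \<rightharpoonup> \<sim> c))" using A c by (simp add: imp_mult)
  also have "A \<odot> (A \<rightharpoonup> \<sim> c) = \<sim> c"
  proof -
    \<comment> \<open>Here the nonzero square of \<open>b\<close> enters: it puts \<open>c\<close>
      strictly above \<open>\<sim> A\<close>, so the maximum is \<open>c\<close>.\<close>
    have "\<not> A \<le> \<sim> c" using bb assms le_neg_iff[of c A] A c mult_commute[of A c] by simp
    then show ?thesis using A c by (simp add: mult_imp_eq_min)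
  qed
  finally show ?thesis using c by (simp add: bb flip: A_def c_def e_def)
qed

end

section \<open>Valuations, and the necessity of involutive negation for (P2)\<close>

primrec extend_valuation :: "(real \<Rightarrow> real \<Rightarrow> real) \<Rightarrow> (nat \<Rightarrow> real) \<Rightarrow> form \<Rightarrow> real" where
  "extend_valuation m v (Var n) = v n"
| "extend_valuation m v Bot = 0"
| "extend_valuation m v (\<phi> \<^bold>\<rightarrow> \<psi>) = residuum m (extend_valuation m v \<phi>) (extend_valuation m v \<psi>)"
| "extend_valuation m v (\<phi> \<^bold>& \<psi>) = m (extend_valuation m v \<phi>) (extend_valuation m v \<psi>)"

lemma valuation_extend_valuation:
  assumes "truth_algebra m T" "range v \<subseteq> T"
  shows "valuation m T (extend_valuation m v)"
proof -
  have "extend_valuation m v \<phi> \<in> T" for \<phi>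
    using assms by (induction \<phi>) (auto simp: truth_algebra_def)
  then show ?thesis by (auto simp: valuation_def)
qed

lemma valuation_eqI:
  assumes "valuation m T \<mu>" "valuation m T \<nu>" "\<And>n. \<mu> (Var n) = \<nu> (Var n)"
  shows "\<mu> = \<nu>"
proof
  show "\<mu> \<phi> = \<nu> \<phi>" for \<phi> using assms by (induction \<phi>) (auto simp: valuation_def)
qed

lemma tnorm_truth_algebra: "truth_algebra m T \<Longrightarrow> tnorm m"
  by (simp add: truth_algebra_def tnorm_def)

lemma valuation_unit: "truth_algebra m T \<Longrightarrow> valuation m T \<mu> \<Longrightarrow> \<mu> \<phi> \<in> {0..1}"
  unfolding truth_algebra_def valuation_def by blast

lemma valuation_neg_neg:
  assumes T: "truth_algebra m T" and \<mu>: "valuation m T \<mu>"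
  shows "valuation m T (\<lambda>\<phi>. residuum m (residuum m (\<mu> \<phi>) 0) 0)"
proof -
  interpret tnorm m using T by (rule tnorm_truth_algebra)
  have "\<mu> \<phi> \<in> T" for \<phi> using \<mu> by (auto simp: valuation_def)
  then have "range (\<lambda>\<phi>. \<sim> \<sim> \<mu> \<phi>) \<subseteq> T" using T by (auto simp: truth_algebra_def)
  then show ?thesis
    using \<mu> valuation_unit[OF T \<mu>]
    by (simp add: valuation_def neg_neg_mult neg_neg_imp neg_zero neg_one)
qed

text \<open>Pointwise \<open>\<mu> \<le> \<sim> \<sim> \<mu>\<close>, so (P2) cannot separate the
  two valuations in this order and they must coincide.\<close>

lemma P2_neg_neg:
  assumes "P2 L" and L: "real_valued_logic L m T" and \<mu>: "valuation m T \<mu>"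
  shows "residuum m (residuum m (\<mu> \<phi>) 0) 0 = \<mu> \<phi>"
proof -
  have T: "truth_algebra m T" using L by (simp add: real_valued_logic_def)
  interpret tnorm m using T by (rule tnorm_truth_algebra)
  let ?\<nu> = "\<lambda>\<phi>. \<sim> \<sim> \<mu> \<phi>"
  have "\<mu> = ?\<nu>"
  proof (rule ccontr)
    assume "\<mu> \<noteq> ?\<nu>"
    then obtain \<alpha> where "\<mu> \<alpha> > 0" "\<sim> \<sim> \<mu> \<alpha> = 0"
      using assms valuation_neg_neg[OF T \<mu>] unfolding P2_def by blast
    then show False using le_neg_neg[OF valuation_unit[OF T \<mu>], of \<alpha>] by simp
  qed
  then show ?thesis by metis
qed

lemma P2_imp_extension_of_Luk:
  assumes P2: "P2 L" and L: "real_valued_logic L m T"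
  shows "extension_of Luk_axioms L"
proof -
  have BL: "extension_of BL_axioms L" and T: "truth_algebra m T"
    and compl: "\<And>\<alpha>. \<alpha> \<in> L \<longleftrightarrow> (\<forall>\<mu>. valuation m T \<mu> \<longrightarrow> \<mu> \<alpha> = 1)"
    using L by (auto simp: real_valued_logic_def)
  interpret tnorm m using T by (rule tnorm_truth_algebra)
  have dn: "Neg (Neg \<phi>) \<^bold>\<rightarrow> \<phi> \<in> L" for \<phi>
    unfolding compl
  proof (intro allI impI)
    fix \<mu> assume \<mu>: "valuation m T \<mu>"
    then have "\<mu> (Neg (Neg \<phi>) \<^bold>\<rightarrow> \<phi>) = \<sim> \<sim> \<mu> \<phi> \<rightharpoonup> \<mu> \<phi>" by (simp add: valuation_def)
    then show "\<mu> (Neg (Neg \<phi>) \<^bold>\<rightarrow> \<phi>) = 1"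
      using P2_neg_neg[OF P2 L \<mu>] valuation_unit[OF T \<mu>] by (simp add: imp_eq_one_iff)
  qed
  have closed: "\<phi> \<in> L" if "derives BL_axioms L \<phi>" for \<phi>
    using BL that by (simp add: extension_of_def)
  have "\<phi> \<in> L" if "derives Luk_axioms L \<phi>" for \<phi>
    using that
  proof induction
    case (axiom \<phi>)
    then show ?case using dn closed derives.axiom by (auto simp: Luk_axioms_def)
  next
    case (mp \<phi> \<psi>)
    then show ?case using closed derives.mp derives.hyp by metis
  qed
  \<comment> \<open>Consistency also transfers: a derivation of \<open>Bot\<close> from
    \<open>Luk_axioms\<close> would put \<open>Bot\<close> into \<open>L\<close>, where it is
    derivable as a hypothesis in BL.\<close>
  then show ?thesis
    using BL derives.hyp unfolding extension_of_def by blast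
qed

section \<open>Separation of valuations under involutive negation\<close>

text \<open>Involution is demanded on \<open>T\<close> only, since it may fail elsewhere in the unit
  interval.\<close>

locale involutive_truth_algebra = tnorm +
  fixes T :: "real set"
  assumes truth: "truth_algebra m T"
    and involutive: "x \<in> T \<Longrightarrow> \<sim> \<sim> x = x"
begin

lemma valuation_simps:
  assumes "valuation m T \<mu>"
  shows "\<mu> Bot = 0" "\<mu> (\<phi> \<^bold>& \<psi>) = \<mu> \<phi> \<odot> \<mu> \<psi>" "\<mu> (\<phi> \<^bold>\<rightarrow> \<psi>) = \<mu> \<phi> \<rightharpoonup> \<mu> \<psi>"
    "\<mu> \<phi> \<in> {0..1}" "\<sim> \<sim> \<mu> \<phi> = \<mu> \<phi>"
  using assms valuation_unit[OF truth assms] involutive[of "\<mu> \<phi>"]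
  by (auto simp: valuation_def image_subset_iff)

lemma neg_nonzero:
  assumes "x \<in> T" "x < 1"
  shows "\<sim> x \<noteq> 0"
  using involutive[of x] assms neg_zero by auto

text \<open>Induction on the number \<open>k\<close> of squarings that annihilate the residuum; each
  doubling step uses up one. Negation exchanges the larger and the smaller value, which is why the
  conclusion is symmetric and both valuations are generalised.\<close>

lemma zero_in_one_valuation:
  assumes "valuation m T \<mu>" "valuation m T \<nu>" "\<mu> \<alpha> < \<nu> \<alpha>"
    and "((\<lambda>z. z \<odot> z) ^^ k) (\<nu> \<alpha> \<rightharpoonup> \<mu> \<alpha>) = 0"
  shows "\<exists>\<beta>. (\<mu> \<beta> = 0) \<noteq> (\<nu> \<beta> = 0)"
  using assms
proof (induction k arbitrary: \<mu> \<nu> \<alpha>)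
  case 0
  note \<mu> = valuation_simps[OF \<open>valuation m T \<mu>\<close>] and \<nu> = valuation_simps[OF \<open>valuation m T \<nu>\<close>]
  \<comment> \<open>For \<open>k = 0\<close> the residuum itself is 0, and it bounds
    \<open>\<mu> \<alpha>\<close> from above.\<close>
  have "\<mu> \<alpha> \<le> 0" using le_imp[of "\<nu> \<alpha>" "\<mu> \<alpha>"] 0 \<mu>(4) \<nu>(4) by simp
  then have "\<mu> \<alpha> = 0" using \<mu>(4)[of \<alpha>] by (simp add: atLeastAtMost_iff)
  then show ?case using 0 by (intro exI[of _ \<alpha>]) simp
next
  case (Suc k)
  \<comment> \<open>Stated for arbitrary valuations so that it also serves
    \<open>Neg \<alpha>\<close> with the two valuations exchanged.\<close>
  have square_step: "\<exists>\<gamma>. (\<mu>' \<gamma> = 0) \<noteq> (\<nu>' \<gamma> = 0)"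
    if v: "valuation m T \<mu>'" "valuation m T \<nu>'" and less: "\<mu>' \<beta> < \<nu>' \<beta>"
      and nil: "((\<lambda>z. z \<odot> z) ^^ Suc k) (\<nu>' \<beta> \<rightharpoonup> \<mu>' \<beta>) = 0"
      and nz: "\<mu>' \<beta> \<odot> \<mu>' \<beta> \<noteq> 0" for \<mu>' \<nu>' \<beta>
  proof (rule Suc.IH[OF v, of "\<beta> \<^bold>& \<beta>"])
    note \<mu>' = valuation_simps[OF v(1)] and \<nu>' = valuation_simps[OF v(2)]
    let ?e = "\<nu>' \<beta> \<rightharpoonup> \<mu>' \<beta>"
    have e: "?e \<in> {0..1}" using \<mu>'(4) \<nu>'(4) by simp
    have eq: "\<nu>' (\<beta> \<^bold>& \<beta>) \<rightharpoonup> \<mu>' (\<beta> \<^bold>& \<beta>) = ?e \<odot> ?e"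
      using imp_squares[of "\<nu>' \<beta>" "\<mu>' \<beta>"] \<mu>' \<nu>' less nz by simp
    then show "((\<lambda>z. z \<odot> z) ^^ k) (\<nu>' (\<beta> \<^bold>& \<beta>) \<rightharpoonup> \<mu>' (\<beta> \<^bold>& \<beta>)) = 0"
      using nil by (simp add: funpow_Suc_right del: funpow.simps)
    have "?e \<noteq> 1" using imp_eq_one_iff[of "\<nu>' \<beta>" "\<mu>' \<beta>"] \<mu>'(4) \<nu>'(4) less by simp
    then have "?e \<odot> ?e \<noteq> 1" using mult_le_left[OF e e] e by (auto simp: atLeastAtMost_iff)
    then show "\<mu>' (\<beta> \<^bold>& \<beta>) < \<nu>' (\<beta> \<^bold>& \<beta>)"
      using eq imp_eq_one_iff[of "\<nu>' (\<beta> \<^bold>& \<beta>)" "\<mu>' (\<beta> \<^bold>& \<beta>)"] \<mu>'(4) \<nu>'(4) by force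
  qed
  note \<mu> = valuation_simps[OF \<open>valuation m T \<mu>\<close>] and \<nu> = valuation_simps[OF \<open>valuation m T \<nu>\<close>]
  let ?x = "\<mu> \<alpha>" and ?y = "\<nu> \<alpha>"
  have x: "?x \<in> {0..1}" "\<sim> \<sim> ?x = ?x" and y: "?y \<in> {0..1}" "\<sim> \<sim> ?y = ?y" using \<mu> \<nu> by auto
  consider "?x \<odot> ?x \<noteq> 0" | "?x \<odot> ?x = 0" "?y \<odot> ?y \<noteq> 0"
    | "?x \<odot> ?x = 0" "?y \<odot> ?y = 0" "\<sim> ?y \<odot> \<sim> ?y \<noteq> 0"
    | "?x \<odot> ?x = 0" "?y \<odot> ?y = 0" "\<sim> ?y \<odot> \<sim> ?y = 0" by blast
  then show ?case
  proof cases
    case 1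
    then show ?thesis using square_step Suc.prems by blast
  next
    case 2
    then show ?thesis using \<mu> \<nu> by (intro exI[of _ "\<alpha> \<^bold>& \<alpha>"]) simp
  next
    case 3
    \<comment> \<open>Contraposition preserves the residuum, so the same \<open>k\<close> still
      applies after negating.\<close>
    have "\<sim> ?x \<rightharpoonup> \<sim> ?y = ?y \<rightharpoonup> ?x" using imp_left_commute[of "\<sim> ?x" ?y 0] x y by simp
    moreover have "\<sim> ?y < \<sim> ?x"
      using imp_antimono_left[of ?x ?y 0] Suc.prems(3) x y by (metis less_eq_real_def less_irrefl zero_closed)
    ultimately have "\<exists>\<gamma>. (\<nu> \<gamma> = 0) \<noteq> (\<mu> \<gamma> = 0)"
      using square_step[of \<nu> \<mu> "Neg \<alpha>"] Suc.prems 3 \<mu>(1,3) \<nu>(1,3) by simp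
    then show ?thesis by blast
  next
    case 4
    have "\<sim> ?x \<odot> \<sim> ?x \<noteq> 0"
    proof
      \<comment> \<open>Vanishing squares would give
        \<open>?y \<le> \<sim> ?y \<le> \<sim> ?x \<le> ?x\<close>, against
        \<open>?x < ?y\<close>.\<close>
      assume "\<sim> ?x \<odot> \<sim> ?x = 0"
      then have "\<sim> ?x \<le> ?x" using le_neg_iff[of "\<sim> ?x" "\<sim> ?x"] x by simp
      moreover have "?y \<le> \<sim> ?y" using 4 le_neg_iff y by simp
      moreover have "\<sim> ?y \<le> \<sim> ?x" using imp_antimono_left[of ?x ?y 0] Suc.prems(3) x y by simp
      ultimately show False using Suc.prems(3) by linarith
    qed
    then show ?thesis using 4 \<mu> \<nu> by (intro exI[of _ "Neg \<alpha> \<^bold>& Neg \<alpha>"]) simp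
  qed
qed

lemma separating_formula:
  assumes \<mu>: "valuation m T \<mu>" and \<nu>: "valuation m T \<nu>" and "\<mu> \<noteq> \<nu>"
  shows "\<exists>\<alpha>. \<mu> \<alpha> > 0 \<and> \<nu> \<alpha> = 0"
proof -
  note M = valuation_simps[OF \<mu>] and N = valuation_simps[OF \<nu>]
  have one_zero: "\<exists>\<beta>. (\<mu>' \<beta> = 0) \<noteq> (\<nu>' \<beta> = 0)"
    if v: "valuation m T \<mu>'" "valuation m T \<nu>'" and less: "\<mu>' \<alpha> < \<nu>' \<alpha>" for \<mu>' \<nu>' \<alpha>
  proof -
    note \<mu>' = valuation_simps[OF v(1)] and \<nu>' = valuation_simps[OF v(2)]
    let ?e = "\<nu>' \<alpha> \<rightharpoonup> \<mu>' \<alpha>"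
    have e: "?e \<in> {0..1}" using \<mu>'(4) \<nu>'(4) by simp
    have "?e \<noteq> 1" using imp_eq_one_iff[of "\<nu>' \<alpha>" "\<mu>' \<alpha>"] \<mu>'(4) \<nu>'(4) less by simp
    \<comment> \<open>Membership in \<open>T\<close> makes double negation fix the residuum, so
      being below 1 gives it a nonzero negation.\<close>
    moreover have "?e \<in> T"
      using v truth by (simp add: valuation_def truth_algebra_def image_subset_iff)
    ultimately have "\<sim> ?e \<noteq> 0" using neg_nonzero e by (simp add: atLeastAtMost_iff)
    then show ?thesis using squares_nilpotent[OF e] zero_in_one_valuation[OF v less] by blast
  qed
  obtain n where "\<mu> (Var n) \<noteq> \<nu> (Var n)" using valuation_eqI[OF \<mu> \<nu>] \<open>\<mu> \<noteq> \<nu>\<close> by blast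
  then have "\<exists>\<beta>. (\<mu> \<beta> = 0) \<noteq> (\<nu> \<beta> = 0)"
    using one_zero[OF \<mu> \<nu>] one_zero[OF \<nu> \<mu>] by (metis linorder_neqE_linordered_idom)
  then obtain \<beta> where \<beta>: "(\<mu> \<beta> = 0) \<noteq> (\<nu> \<beta> = 0)" by blast
  show ?thesis
  proof (cases "\<nu> \<beta> = 0")
    case True
    then show ?thesis using \<beta> M(4)[of \<beta>] by (intro exI[of _ \<beta>]) (auto simp: atLeastAtMost_iff)
  next
    case False
    \<comment> \<open>The formula separates in the wrong direction. Its negation is 1 under
      \<open>\<mu>\<close> and stays 1 under squaring, while its value under \<open>\<nu>\<close> is
      driven to 0.\<close>
    have "\<mu> (Neg \<beta>) = 1" using \<beta> False M by (simp add: neg_zero)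
    moreover have "\<sim> \<nu> (Neg \<beta>) \<noteq> 0" using False N by simp
    ultimately obtain k where k: "((\<lambda>z. z \<odot> z) ^^ k) (\<nu> (Neg \<beta>)) = 0" and one: "\<mu> (Neg \<beta>) = 1"
      using squares_nilpotent N(4) by blast
    let ?\<gamma> = "((\<lambda>\<phi>. \<phi> \<^bold>& \<phi>) ^^ k) (Neg \<beta>)"
    have "\<mu> ?\<gamma> = 1" by (induction k) (use one M mult_one_right in simp_all)
    moreover have "\<nu> (((\<lambda>\<phi>. \<phi> \<^bold>& \<phi>) ^^ j) (Neg \<beta>)) = ((\<lambda>z. z \<odot> z) ^^ j) (\<nu> (Neg \<beta>))" for j
      by (induction j) (use N in simp_all)
    ultimately show ?thesis using k by (intro exI[of _ ?\<gamma>]) simp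
  qed
qed

end

section \<open>From the double negation schema to involution, and the equivalence\<close>

lemma extension_of_Luk_imp_involutive:
  assumes Luk: "extension_of Luk_axioms L" and L: "real_valued_logic L m T"
  shows "involutive_truth_algebra m T"
proof -
  have T: "truth_algebra m T"
    and compl: "\<And>\<alpha>. \<alpha> \<in> L \<longleftrightarrow> (\<forall>\<mu>. valuation m T \<mu> \<longrightarrow> \<mu> \<alpha> = 1)"
    using L by (auto simp: real_valued_logic_def)
  interpret tnorm m using T by (rule tnorm_truth_algebra)
  have "\<sim> \<sim> x = x" if "x \<in> T" for x
  proof -
    have "Neg (Neg (Var 0)) \<^bold>\<rightarrow> Var 0 \<in> Luk_axioms" by (auto simp: Luk_axioms_def)
    then have "Neg (Neg (Var 0)) \<^bold>\<rightarrow> Var 0 \<in> L"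
      using Luk by (simp add: extension_of_def derives.axiom)
    \<comment> \<open>The constant assignment makes the arbitrary \<open>x\<close> a value of
      \<open>Var 0\<close>, turning the schema into a pointwise law on \<open>T\<close>.\<close>
    moreover have "valuation m T (extend_valuation m (\<lambda>_. x))"
      using valuation_extend_valuation[OF T] that by auto
    ultimately have "extend_valuation m (\<lambda>_. x) (Neg (Neg (Var 0)) \<^bold>\<rightarrow> Var 0) = 1"
      using compl by blast
    then have "\<sim> \<sim> x \<rightharpoonup> x = 1" by simp
    moreover have "x \<in> {0..1}" using T that by (auto simp: truth_algebra_def)
    ultimately show ?thesis using imp_eq_one_iff[of "\<sim> \<sim> x" x] le_neg_neg[of x] by simp
  qed
  then show ?thesis using T by unfold_locales
qed

theorem mainTheorem2:
  fixes L :: "form set" and m :: "real \<Rightarrow> real \<Rightarrow> real" and T :: "real set"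
  assumes "real_valued_logic L m T"
  shows "P2 L \<longleftrightarrow> extension_of Luk_axioms L"
proof
  assume "P2 L"
  then show "extension_of Luk_axioms L" using P2_imp_extension_of_Luk assms by blast
next
  assume "extension_of Luk_axioms L"
  \<comment> \<open>(P2) ranges over all truth algebras inducing \<open>L\<close>, and involution
    holds in each of them, not just in the given one.\<close>
  then show "P2 L"
    unfolding P2_def
    by (metis extension_of_Luk_imp_involutive involutive_truth_algebra.separating_formula)
qed

end
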